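(* Let $G=(V(G),E(G),w)$ be a finite weighted graph with $w:E(G)\to\mathbb{R}_{\ge 0}$ and order $n\ge 3$. Then $G$ admits a $3$-partition $(X_1,X_2,X_3)$ of $V(G)$ into three non-empty parts such that both (i) $w(X_1,X_2,X_3)\ge \frac{2w(G)}{3}+\frac{d_w(G)}{3}$, and (ii) $\max\{w(G[X_1]),w(G[X_2]),w(G[X_3])\}\le \frac{w(G)}{9}+\frac{\Delta_w(G)}{9}$.
   Context: For a weighted graph $G$, $w(G)$ is the total weight of its edges and $w(G[S])$ is the total weight of edges with both endpoints in $S\subseteq V(G)$. The weighted degree of a vertex $v$ is $w(v)=\sum_{u\in N(v)}w(vu)$; $\Delta_w(G)=\max_{v}w(v)$ is the maximum weighted degree and $d_w(G)=\frac{2w(G)}{|V(G)|}$ is the average weighted degree. For disjoint non-empty sets $X_1,\dots,X_k$, $w(X_1,\dots,X_k)$ denotes the total weight of edges with endpoints in two different sets $X_i,X_j$, $i\ne j$. *)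

theory Defs
  imports Complex_Main "HOL-Library.Disjoint_Sets"
begin

text \<open>
  A finite simple graph has a finite vertex set \<open>V\<close> and a set \<open>E\<close> of two-element subsets
  of \<open>V\<close> as edges.  The weight function matters only on \<open>E\<close>; its values elsewhere
  are unconstrained and no definition below refers to them.
\<close>

locale weighted_graph =
  fixes V :: "'a set" and E :: "'a set set" and w :: "'a set \<Rightarrow> real"
  assumes finite_vertices: "finite V"
    and edges: "e \<in> E \<Longrightarrow> e \<subseteq> V \<and> card e = 2"
    and weight_nonneg: "e \<in> E \<Longrightarrow> 0 \<le> w e"

definition total_weight :: "'a set set \<Rightarrow> ('a set \<Rightarrow> real) \<Rightarrow> real" where
  "total_weight E w = (\<Sum>e\<in>E. w e)"

definition induced_edges :: "'a set set \<Rightarrow> 'a set \<Rightarrow> 'a set set" where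
  "induced_edges E S = {e \<in> E. e \<subseteq> S}"

definition neighbours :: "'a set set \<Rightarrow> 'a \<Rightarrow> 'a set" where
  "neighbours E v = {u. {v, u} \<in> E}"

definition weighted_degree :: "'a set set \<Rightarrow> ('a set \<Rightarrow> real) \<Rightarrow> 'a \<Rightarrow> real" where
  "weighted_degree E w v = (\<Sum>u\<in>neighbours E v. w {v, u})"

definition max_weighted_degree :: "'a set \<Rightarrow> 'a set set \<Rightarrow> ('a set \<Rightarrow> real) \<Rightarrow> real" where
  "max_weighted_degree V E w = Max (weighted_degree E w ` V)"

definition avg_weighted_degree :: "'a set \<Rightarrow> 'a set set \<Rightarrow> ('a set \<Rightarrow> real) \<Rightarrow> real" where
  "avg_weighted_degree V E w = 2 * total_weight E w / real (card V)"

definition k_partition :: "nat \<Rightarrow> 'a set \<Rightarrow> (nat \<Rightarrow> 'a set) \<Rightarrow> bool" where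
  "k_partition k V X \<longleftrightarrow>
     (\<forall>i\<in>{1..k}. X i \<noteq> {}) \<and> disjoint_family_on X {1..k} \<and> (\<Union>i\<in>{1..k}. X i) = V"

definition crossing_edges :: "'a set set \<Rightarrow> nat \<Rightarrow> (nat \<Rightarrow> 'a set) \<Rightarrow> 'a set set" where
  "crossing_edges E k X =
     {e \<in> E. \<exists>i\<in>{1..k}. \<exists>j\<in>{1..k}. i \<noteq> j \<and> (\<exists>u\<in>X i. \<exists>v\<in>X j. e = {u, v})}"

end

theory Submission
  imports Defs
begin

text \<open>
  Write \<open>W S\<close> for the weight inside \<open>S\<close>, \<open>D\<close> for the maximum degree and
  \<open>t = (W V + D) / 9\<close>.  A random partition into parts of nearly equal size satisfies (i), so a
  3-partition \<open>X1, X2, X3\<close> of minimum inside weight does.  If \<open>W X1 > t\<close>, discard vertices of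
  \<open>X1\<close> until the weight of the remainder \<open>U\<close> first drops to \<open>t\<close>, and let the last
  discarded vertex have degree \<open>s\<close> into \<open>U\<close>.  Optimality sends at least twice as much weight
  from each vertex of \<open>X1\<close> outside \<open>X1\<close> as inside, whence
  \<open>W (V - U) \<le> W V - 5 W U - 3 s\<close>, about four ninths of the total.  Now bisect \<open>V - U\<close>
  optimally and, if a part exceeds \<open>t\<close>, shrink it in the same way to \<open>U'\<close>.  The rest is then
  light enough unless the vertex \<open>v'\<close> discarded last has small degree into \<open>U\<close>; in that case
  moving \<open>v'\<close> to \<open>U\<close> removes so much weight from the complement that repeating the
  bisection succeeds.
\<close>

section \<open>Degrees, cuts and inside weights of a symmetric weight function\<close>

locale edge_weights =
  fixes f :: "'a \<Rightarrow> 'a \<Rightarrow> real"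
  assumes sym: "f u v = f v u"
    and nonneg: "0 \<le> f u v"
    and diag: "f u u = 0"
begin

definition deg :: "'a \<Rightarrow> 'a set \<Rightarrow> real" where
  "deg v S = (\<Sum>u\<in>S. f v u)"

definition cut :: "'a set \<Rightarrow> 'a set \<Rightarrow> real" where
  "cut S T = (\<Sum>u\<in>S. deg u T)"

text \<open>\<open>cut S S\<close> sums every pair in both orders, hence the half; by
  \<open>diag\<close> a vertex paired with itself adds nothing.\<close>

definition W :: "'a set \<Rightarrow> real" where
  "W S = cut S S / 2"

lemma deg_nonneg: "0 \<le> deg v S"
  by (simp add: deg_def sum_nonneg nonneg)

lemma cut_nonneg: "0 \<le> cut S T"
  by (simp add: cut_def sum_nonneg deg_nonneg)

lemma W_nonneg: "0 \<le> W S"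
  by (simp add: W_def cut_nonneg)

lemma deg_Un:
  "finite A \<Longrightarrow> finite B \<Longrightarrow> A \<inter> B = {} \<Longrightarrow> deg v (A \<union> B) = deg v A + deg v B"
  by (simp add: deg_def sum.union_disjoint)

lemma deg_mono: "finite B \<Longrightarrow> A \<subseteq> B \<Longrightarrow> deg v A \<le> deg v B"
  by (simp add: deg_def nonneg sum_mono2)

lemma deg_insert_self: "finite A \<Longrightarrow> deg v (insert v A) = deg v A"
  by (simp add: deg_def sum.insert_if diag)

lemma cut_commute: "cut A B = cut B A"
  unfolding cut_def deg_def by (subst sum.swap) (simp add: sym)

lemma cut_Un_right:
  "finite B \<Longrightarrow> finite C \<Longrightarrow> B \<inter> C = {} \<Longrightarrow> cut A (B \<union> C) = cut A B + cut A C"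
  by (simp add: cut_def deg_Un sum.distrib)

lemma cut_Un_left:
  "finite A \<Longrightarrow> finite B \<Longrightarrow> A \<inter> B = {} \<Longrightarrow> cut (A \<union> B) C = cut A C + cut B C"
  by (simp add: cut_def sum.union_disjoint)

lemma cut_mono_right: "finite C \<Longrightarrow> B \<subseteq> C \<Longrightarrow> cut A B \<le> cut A C"
  by (simp add: cut_def deg_mono sum_mono)

lemma cut_singleton: "cut {v} A = deg v A"
  by (simp add: cut_def)

lemma W_Un:
  assumes "finite A" "finite B" "A \<inter> B = {}"
  shows "W (A \<union> B) = W A + W B + cut A B"
  using assms cut_commute[of B A]
  by (simp add: W_def cut_Un_left cut_Un_right field_simps)

lemma W_empty [simp]: "W {} = 0"
  by (simp add: W_def cut_def)

lemma W_singleton [simp]: "W {v} = 0"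
  by (simp add: W_def cut_def deg_def diag)

lemma W_insert:
  assumes "finite A" "v \<notin> A"
  shows "W (insert v A) = W A + deg v A"
  using W_Un[of "{v}" A] assms by (simp add: cut_singleton)

lemma W_remove:
  assumes "finite A" "v \<in> A"
  shows "W (A - {v}) = W A - deg v A"
  using W_insert[of "A - {v}" v] deg_insert_self[of "A - {v}" v] assms
  by (simp add: insert_absorb)

text \<open>A single vertex has no inside weight. This keeps a heavy part non-empty when one vertex
  is moved out of it.\<close>

lemma card_ge2_of_W_pos:
  assumes "finite A" "0 < W A" "v \<in> A"
  shows "A - {v} \<noteq> {}"
  using assms by (metis W_empty W_singleton insert_Diff less_irrefl)

section \<open>Averages over subsets of fixed size\<close>

text \<open>Double counting: two distinct vertices of \<open>S\<close> are both missed by exactly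
  \<open>(card S - 2) choose r\<close> of the \<open>r\<close>-subsets.\<close>

lemma sum_W_complements:
  assumes S: "finite S" "2 \<le> card S"
  shows "(\<Sum>U | U \<subseteq> S \<and> card U = r. W (S - U)) = ((card S - 2) choose r) * W S"
proof -
  let ?F = "{U. U \<subseteq> S \<and> card U = r}"
  have finF: "finite ?F"
    using S by (auto intro: finite_subset[of _ "Pow S"])
  have W_ind: "W (S - U) = (\<Sum>u\<in>S. \<Sum>v\<in>S. if u \<notin> U \<and> v \<notin> U then f u v else 0) / 2" for U
  proof -
    have "(\<Sum>v\<in>S. if u \<notin> U \<and> v \<notin> U then f u v else 0) = (if u \<notin> U then deg u (S - U) else 0)" for u
      unfolding deg_def using S
      by (auto simp: sum.If_cases Diff_eq Collect_neg_eq intro!: sum.cong)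
    then show ?thesis
      unfolding W_def cut_def using S by (simp add: sum.If_cases Diff_eq Collect_neg_eq)
  qed
  have count: "(\<Sum>U\<in>?F. if u \<notin> U \<and> v \<notin> U then f u v else 0) = ((card S - 2) choose r) * f u v"
    if uv: "u \<in> S" "v \<in> S" for u v
  proof (cases "u = v")
    case True
    show ?thesis unfolding True by (simp add: diag cong: if_cong)
  next
    case False
    have "?F \<inter> {U. u \<notin> U \<and> v \<notin> U} = {U. U \<subseteq> S - {u, v} \<and> card U = r}" by auto
    moreover have "card (S - {u, v}) = card S - 2"
      using False S uv by (simp add: card_Diff_subset)
    ultimately have "card (?F \<inter> {U. u \<notin> U \<and> v \<notin> U}) = (card S - 2) choose r"
      using n_subsets[of "S - {u, v}" r] S by simp
    then show ?thesis using finF by (simp add: sum.If_cases)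
  qed
  have "(\<Sum>U\<in>?F. W (S - U)) = (\<Sum>u\<in>S. \<Sum>v\<in>S. \<Sum>U\<in>?F. if u \<notin> U \<and> v \<notin> U then f u v else 0) / 2"
    unfolding W_ind by (simp add: sum_divide_distrib[symmetric] sum.swap[of _ _ ?F])
  also have "\<dots> = (\<Sum>u\<in>S. \<Sum>v\<in>S. ((card S - 2) choose r) * f u v) / 2"
    by (simp add: count)
  also have "\<dots> = ((card S - 2) choose r) * W S"
    by (simp add: W_def cut_def deg_def sum_distrib_left)
  finally show ?thesis .
qed

text \<open>Two applications of the absorption identity. Divided out, this is the probability that a
  random \<open>j\<close>-subset misses two given elements.\<close>

lemma choose_minus_two:
  assumes "j \<le> n" "2 \<le> n"
  shows "real ((n - 2) choose j) * (real n * (real n - 1))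
    = real (n choose j) * ((real n - real j) * (real n - real j - 1))"
proof (cases "j = n")
  \<comment> \<open>Here the natural number \<open>n - 1 - j\<close> would be truncated, so the
    conversion to reals below fails; both sides vanish.\<close>
  case True
  then show ?thesis using assms by simp
next
  case False
  have 1: "real ((n - 1) choose j) * real n = real (n choose j) * (real n - real j)"
    using arg_cong[OF binomial_absorb_comp[of n j], of real] assms(1)
    by (simp add: of_nat_diff mult.commute)
  have 2: "real ((n - 2) choose j) * (real n - 1) = real ((n - 1) choose j) * (real n - real j - 1)"
  proof -
    have "real (n - 1 - j) = real n - real j - 1" "real (n - 1) = real n - 1" "n - 1 - 1 = n - 2"
      using assms False by (auto simp: of_nat_diff)
    then show ?thesis
      using arg_cong[OF binomial_absorb_comp[of "n - 1" j], of real] by (simp add: mult.commute)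
  qed
  show ?thesis
    using arg_cong[OF 1, of "\<lambda>z. z * (real n - real j - 1)"] arg_cong[OF 2, of "\<lambda>z. z * real n"]
    by (simp add: algebra_simps)
qed

text \<open>Some \<open>U\<close> is no worse than the mean over all \<open>r\<close>-subsets. The
  coefficients allow charging \<open>S - U\<close> only for the share of its weight that survives a
  later bisection.\<close>

lemma exists_subset_le_average:
  fixes \<alpha> \<beta> :: real
  assumes S: "finite S" "2 \<le> card S" and r: "r \<le> card S"
  defines "n \<equiv> real (card S)"
  obtains U where "U \<subseteq> S" "card U = r"
    "(\<alpha> * W U + \<beta> * W (S - U)) * (n * (n - 1))
      \<le> (\<alpha> * (real r * (real r - 1)) + \<beta> * ((n - r) * (n - r - 1))) * W S"
proof -
  let ?F = "\<lambda>r. {U. U \<subseteq> S \<and> card U = r}"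
  have finF: "finite (?F r)"
    using S by (auto intro: finite_subset[of _ "Pow S"])
  have card_compl: "card (S - U) = card S - card U" if "U \<subseteq> S" for U
    using that S by (meson card_Diff_subset finite_subset)
  \<comment> \<open>Complementation exchanges \<open>r\<close>-subsets with subsets of size
    \<open>card S - r\<close>, so \<open>sum_W_complements\<close> also evaluates the sum of
    \<open>W U\<close>.\<close>
  have complement: "(\<Sum>U\<in>?F r. W U) = (\<Sum>U\<in>?F (card S - r). W (S - U))"
    by (rule sum.reindex_bij_witness[of _ "\<lambda>U. S - U" "\<lambda>U. S - U"])
      (use r in \<open>auto simp: card_compl double_diff\<close>)
  have inside: "(\<Sum>U\<in>?F r. W U) * (n * (n - 1)) = (card S choose r) * (real r * (real r - 1)) * W S"
  proof -
    have "real ((card S - 2) choose (card S - r)) * (n * (n - 1)) = (card S choose r) * (real r * (real r - 1))"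
      using choose_minus_two[of "card S - r" "card S"] S r binomial_symmetric[OF r]
      by (simp add: n_def of_nat_diff)
    then show ?thesis
      unfolding complement sum_W_complements[OF S] by (metis mult.commute mult.left_commute)
  qed
  have outside: "(\<Sum>U\<in>?F r. W (S - U)) * (n * (n - 1))
      = (card S choose r) * ((n - r) * (n - r - 1)) * W S"
  proof -
    have "real ((card S - 2) choose r) * (n * (n - 1)) = (card S choose r) * ((n - r) * (n - r - 1))"
      using choose_minus_two[of r "card S"] S r by (simp add: n_def)
    then show ?thesis
      unfolding sum_W_complements[OF S] by (metis mult.commute mult.left_commute)
  qed
  let ?c = "(\<alpha> * (real r * (real r - 1)) + \<beta> * ((n - r) * (n - r - 1))) * W S"
  have "\<exists>U\<in>?F r. (\<alpha> * W U + \<beta> * W (S - U)) * (n * (n - 1)) \<le> ?c"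
  proof (rule ccontr)
    assume "\<not> ?thesis"
    then have *: "\<And>U. U \<in> ?F r \<Longrightarrow> ?c < (\<alpha> * W U + \<beta> * W (S - U)) * (n * (n - 1))"
      by force
    have "card (?F r) = card S choose r"
      using n_subsets S by blast
    moreover have "card S choose r \<noteq> 0" using r by simp
    ultimately have "?F r \<noteq> {}" by (metis card.empty)
    have "(card S choose r) * ?c = (\<Sum>U\<in>?F r. ?c)"
      using \<open>card (?F r) = _\<close> by simp
    also have "\<dots> < (\<Sum>U\<in>?F r. (\<alpha> * W U + \<beta> * W (S - U)) * (n * (n - 1)))"
      using * \<open>?F r \<noteq> {}\<close> finF by (intro sum_strict_mono) auto
    also have "\<dots> = \<alpha> * ((\<Sum>U\<in>?F r. W U) * (n * (n - 1)))
        + \<beta> * ((\<Sum>U\<in>?F r. W (S - U)) * (n * (n - 1)))"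
      by (simp add: sum_distrib_right sum_distrib_left sum.distrib[symmetric] algebra_simps)
    also have "\<dots> = (card S choose r) * ?c"
      unfolding inside outside by (simp add: algebra_simps)
    finally show False by simp
  qed
  then show thesis using that by blast
qed

section \<open>Optimal partitions into two and three non-empty parts\<close>

definition bip :: "'a set \<Rightarrow> 'a set \<Rightarrow> 'a set \<Rightarrow> bool" where
  "bip S Y Z \<longleftrightarrow> Y \<noteq> {} \<and> Z \<noteq> {} \<and> Y \<inter> Z = {} \<and> Y \<union> Z = S"

definition min_bip :: "'a set \<Rightarrow> 'a set \<Rightarrow> 'a set \<Rightarrow> bool" where
  "min_bip S Y Z \<longleftrightarrow> bip S Y Z \<and> (\<forall>Y' Z'. bip S Y' Z' \<longrightarrow> W Y + W Z \<le> W Y' + W Z')"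

definition tri :: "'a set \<Rightarrow> 'a set \<Rightarrow> 'a set \<Rightarrow> 'a set \<Rightarrow> bool" where
  "tri S X Y Z \<longleftrightarrow> X \<noteq> {} \<and> Y \<noteq> {} \<and> Z \<noteq> {} \<and> X \<inter> Y = {} \<and> X \<inter> Z = {} \<and> Y \<inter> Z = {}
    \<and> X \<union> Y \<union> Z = S"

definition min_tri :: "'a set \<Rightarrow> 'a set \<Rightarrow> 'a set \<Rightarrow> 'a set \<Rightarrow> bool" where
  "min_tri S X Y Z \<longleftrightarrow> tri S X Y Z \<and>
    (\<forall>X' Y' Z'. tri S X' Y' Z' \<longrightarrow> W X + W Y + W Z \<le> W X' + W Y' + W Z')"

lemma tri_bip: "U \<noteq> {} \<Longrightarrow> U \<subseteq> S \<Longrightarrow> bip (S - U) Y Z \<Longrightarrow> tri S U Y Z"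
  unfolding tri_def bip_def by blast

text \<open>The mean over splits into sizes differing by at most one does not exceed the bound, and
  equals it for odd \<open>card S\<close>.\<close>

lemma exists_bip_le_average:
  assumes S: "finite S" "2 \<le> card S"
  obtains Y Z where "bip S Y Z" "W Y + W Z \<le> W S * (1 - 1 / card S) / 2"
proof -
  define n r where "n = real (card S)" and "r = card S div 2"
  have r: "1 \<le> r" "r < card S" using S unfolding r_def by linarith+
  obtain U where U: "U \<subseteq> S" "card U = r"
    "(1 * W U + 1 * W (S - U)) * (n * (n - 1))
      \<le> (1 * (real r * (real r - 1)) + 1 * ((n - r) * (n - r - 1))) * W S"
    using exists_subset_le_average[of S r 1 1] S r unfolding n_def by auto
  have "bip S U (S - U)"
    using U r unfolding bip_def by auto
  have "n = 2 * real r \<or> n = 2 * real r + 1"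
  proof -
    have "card S = 2 * r \<or> card S = 2 * r + 1" unfolding r_def by linarith
    then show ?thesis unfolding n_def by auto
  qed
  then have "2 * n * (real r * (real r - 1) + (n - r) * (n - r - 1)) \<le> (n - 1) * (n * (n - 1))"
  proof
    assume "n = 2 * real r" then show ?thesis using r by (simp add: algebra_simps)
  next
    assume "n = 2 * real r + 1" then show ?thesis by (simp add: algebra_simps)
  qed
  then have "2 * n * (real r * (real r - 1) + (n - r) * (n - r - 1)) * W S \<le> (n - 1) * (n * (n - 1)) * W S"
    by (rule mult_right_mono[OF _ W_nonneg])
  moreover have "2 * n * ((W U + W (S - U)) * (n * (n - 1)))
      \<le> 2 * n * ((real r * (real r - 1) + (n - r) * (n - r - 1)) * W S)"
    using U(3) by (intro mult_left_mono) (auto simp: n_def)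
  ultimately have "2 * n * ((W U + W (S - U)) * (n * (n - 1))) \<le> (n - 1) * (n * (n - 1)) * W S"
    by (simp only: mult.assoc)
  then have "(n * (n - 1)) * (2 * n * (W U + W (S - U))) \<le> (n * (n - 1)) * ((n - 1) * W S)"
    by (simp add: algebra_simps)
  moreover have n: "n * (n - 1) > 0" "n > 0" using S unfolding n_def by auto
  ultimately have "2 * n * (W U + W (S - U)) \<le> (n - 1) * W S"
    using mult_le_cancel_left_pos by blast
  then have "W U + W (S - U) \<le> W S * (1 - 1 / n) / 2"
    using n by (simp add: field_simps)
  then show thesis using that \<open>bip S U (S - U)\<close> unfolding n_def by blast
qed

lemma exists_tri_le_average:
  assumes S: "finite S" "3 \<le> card S"
  obtains X Y Z where "tri S X Y Z" "W X + W Y + W Z \<le> W S * (1 - 2 / card S) / 3"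
proof -
  \<comment> \<open>\<open>r\<close> is the integer nearest to \<open>n / 3\<close>.\<close>
  define n r where "n = real (card S)" and "r = (card S + 1) div 3"
  have r: "1 \<le> r" "r + 2 \<le> card S" using S unfolding r_def by linarith+
  \<comment> \<open>By \<open>exists_bip_le_average\<close>, at most this share of
    \<open>W (S - U)\<close> stays inside after the second split.\<close>
  define \<beta> where "\<beta> = (1 - 1 / (n - r)) / 2"
  obtain U where U: "U \<subseteq> S" "card U = r"
    "(1 * W U + \<beta> * W (S - U)) * (n * (n - 1))
      \<le> (1 * (real r * (real r - 1)) + \<beta> * ((n - r) * (n - r - 1))) * W S"
    unfolding n_def using exists_subset_le_average[OF S(1) _ _, of r 1 \<beta>] S r by (metis add_leD1 add_leD2)
  have cardU: "card (S - U) = card S - r"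
    using U S by (metis card_Diff_subset finite_subset)
  have "finite (S - U)" "2 \<le> card (S - U)" using S r cardU by auto
  then obtain Y Z where YZ: "bip (S - U) Y Z" "W Y + W Z \<le> W (S - U) * (1 - 1 / card (S - U)) / 2"
    by (rule exists_bip_le_average)
  have "U \<noteq> {}" using U r by auto
  then have "tri S U Y Z" using tri_bip U YZ by blast
  have n: "n * (n - 1) > 0" "n > 0" "n - r > 0" using S r unfolding n_def by auto
  have \<beta>: "\<beta> * ((n - r) * (n - r - 1)) = (n - r - 1)\<^sup>2 / 2"
    unfolding \<beta>_def using n by (simp add: field_simps power2_eq_square)
  \<comment> \<open>Cleared of denominators, the polynomial bound below is exactly
    \<open>(3 * r - n)^2 \<le> 1\<close>.\<close>
  have "\<bar>3 * real r - n\<bar> \<le> 1"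
    unfolding n_def r_def by linarith
  then have "(3 * real r - n)\<^sup>2 \<le> 1" by (simp add: abs_square_le_1)
  then have "real r * (real r - 1) + \<beta> * ((n - r) * (n - r - 1)) \<le> (n - 1) * (n - 2) / 3"
    unfolding \<beta> by (simp add: power2_eq_square field_simps)
  from U(3)[unfolded mult_1] mult_right_mono[OF this W_nonneg]
  have "(W U + \<beta> * W (S - U)) * (n * (n - 1)) \<le> (n - 1) * (n - 2) / 3 * W S"
    by (rule order_trans)
  also have "\<dots> = (W S * (1 - 2 / n) / 3) * (n * (n - 1))"
  proof -
    have "n * (1 - 2 / n) = n - 2" using n by (simp add: right_diff_distrib)
    then have "W S / 3 * (n - 1) * (n * (1 - 2 / n)) = W S / 3 * (n - 1) * (n - 2)" by simp
    then show ?thesis by (simp only: mult_ac times_divide_eq_left times_divide_eq_right)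
  qed
  finally have "W U + \<beta> * W (S - U) \<le> W S * (1 - 2 / n) / 3"
    using n mult_le_cancel_right_pos by blast
  moreover have "W Y + W Z \<le> \<beta> * W (S - U)"
    using YZ(2) cardU r unfolding \<beta>_def n_def by (simp add: of_nat_diff mult.commute)
  ultimately show thesis using that[OF \<open>tri S U Y Z\<close>] unfolding n_def by simp
qed

text \<open>There are finitely many candidates. By symmetry the heavier part may be called
  \<open>Y\<close>, so only one part ever needs shrinking.\<close>

lemma exists_min_bip:
  assumes S: "finite S" "2 \<le> card S"
  obtains Y Z where "min_bip S Y Z" "W Z \<le> W Y"
proof -
  let ?P = "{p. bip S (fst p) (snd p)}" and ?g = "\<lambda>p. W (fst p) + W (snd p)"
  have "?P \<subseteq> Pow S \<times> Pow S" unfolding bip_def by auto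
  then have "finite ?P" using S by (meson finite_Pow_iff finite_SigmaI finite_subset)
  moreover obtain Y0 Z0 where "bip S Y0 Z0" using exists_bip_le_average[OF S] .
  then have "?P \<noteq> {}" by force
  ultimately obtain p where p: "is_arg_min ?g (\<lambda>p. p \<in> ?P) p"
    using ex_is_arg_min_if_finite[of ?P ?g] by blast
  define Y Z where "Y = fst p" and "Z = snd p"
  have "min_bip S Y Z"
    using p unfolding min_bip_def Y_def Z_def is_arg_min_def by (auto simp: not_less)
  moreover from this have "min_bip S Z Y"
    unfolding min_bip_def bip_def by (simp add: Int_commute Un_commute add.commute)
  ultimately show thesis using that by (meson linear)
qed

lemma exists_min_tri:
  assumes S: "finite S" "3 \<le> card S"
  obtains X Y Z where "min_tri S X Y Z"
proof -
  let ?P = "{p. tri S (fst p) (fst (snd p)) (snd (snd p))}"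
    and ?g = "\<lambda>p. W (fst p) + W (fst (snd p)) + W (snd (snd p))"
  have "?P \<subseteq> Pow S \<times> Pow S \<times> Pow S" unfolding tri_def by auto
  then have "finite ?P" using S by (meson finite_Pow_iff finite_SigmaI finite_subset)
  moreover obtain X0 Y0 Z0 where "tri S X0 Y0 Z0" using exists_tri_le_average[OF S] .
  then have "?P \<noteq> {}" by force
  ultimately obtain p where p: "is_arg_min ?g (\<lambda>p. p \<in> ?P) p"
    using ex_is_arg_min_if_finite[of ?P ?g] by blast
  have "min_tri S (fst p) (fst (snd p)) (snd (snd p))"
    using p unfolding min_tri_def is_arg_min_def by (auto simp: not_less)
  then show thesis using that by blast
qed

text \<open>Moving \<open>u\<close> from \<open>Y\<close> to \<open>Z\<close> changes the inside
  weight by \<open>deg u Z - deg u Y\<close>, which optimality makes non-negative.\<close>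

lemma min_bip_move:
  assumes "finite S" "min_bip S Y Z" "u \<in> Y" "0 < W Y"
  shows "deg u Y \<le> deg u Z"
proof -
  have part: "Z \<noteq> {}" "Y \<inter> Z = {}" "Y \<union> Z = S"
    using assms unfolding min_bip_def bip_def by auto
  then have fin: "finite Y" "finite Z" and uZ: "u \<notin> Z" using assms by auto
  have "Y - {u} \<noteq> {}" using card_ge2_of_W_pos fin assms by blast
  then have "bip S (Y - {u}) (insert u Z)"
    using part assms(3) unfolding bip_def by blast
  then have "W Y + W Z \<le> W (Y - {u}) + W (insert u Z)"
    using assms unfolding min_bip_def by blast
  then show ?thesis using W_remove[of Y u] W_insert[of Z u] fin uZ assms by simp
qed

lemma min_tri_swap: "min_tri S X Y Z \<Longrightarrow> min_tri S X Z Y"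
  unfolding min_tri_def tri_def by (simp add: Int_commute Un_ac add_ac)

lemma min_tri_move:
  assumes "finite S" "min_tri S X Y Z" "u \<in> X" "0 < W X"
  shows "deg u X \<le> deg u Y"
proof -
  have part: "Y \<noteq> {}" "Z \<noteq> {}" "X \<inter> Y = {}" "X \<inter> Z = {}" "Y \<inter> Z = {}" "X \<union> Y \<union> Z = S"
    using assms unfolding min_tri_def tri_def by auto
  then have fin: "finite X" "finite Y" and u: "u \<notin> Y" using assms by auto
  have "X - {u} \<noteq> {}" using card_ge2_of_W_pos fin assms by blast
  then have "tri S (X - {u}) (insert u Y) Z"
    using part assms(3) unfolding tri_def by blast
  then have "W X + W Y + W Z \<le> W (X - {u}) + W (insert u Y) + W Z"
    using assms unfolding min_tri_def by blast
  then show ?thesis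
    using W_remove[of X u] W_insert[of Y u] fin u assms by simp
qed

section \<open>Shrinking a heavy part\<close>

text \<open>Split \<open>W S\<close> along \<open>U\<close>. The edges from \<open>U\<close> to
  \<open>S - X\<close> weigh at least \<open>c * cut U X\<close>; \<open>cut U X\<close> is
  \<open>2 * W U\<close> plus \<open>cut U (X - U)\<close>, and the latter is at least
  \<open>deg v U\<close> because \<open>v\<close> lies in \<open>X - U\<close>. Three parts give
  \<open>c = 2\<close>, two give \<open>c = 1\<close>.\<close>

lemma shrink_below_threshold:
  assumes S: "finite S" "X \<subseteq> S" and c: "0 \<le> c"
    and deg: "\<And>u. u \<in> X \<Longrightarrow> c * deg u X \<le> deg u (S - X)"
    and t: "0 \<le> t" "t < W X"
  obtains U v where "U \<subseteq> X" "v \<in> X" "v \<notin> U" "U \<noteq> {}" "W U \<le> t" "t < W U + deg v U"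
    "W (S - U) \<le> W S - (1 + 2 * c) * W U - (1 + c) * deg v U"
    "2 * (W U + deg v U) \<le> (card U + 1) * deg v U"
proof -
  have finX: "finite X" using S finite_subset by blast
  \<comment> \<open>A smallest subset heavier than \<open>t\<close>: removing any vertex brings it
    down to at most \<open>t\<close>.\<close>
  define A where "A = arg_min card (\<lambda>A. A \<subseteq> X \<and> t < W A)"
  have A: "A \<subseteq> X" "t < W A" and A_min: "\<And>B. B \<subseteq> X \<Longrightarrow> t < W B \<Longrightarrow> card A \<le> card B"
    using arg_min_nat_lemma[of "\<lambda>A. A \<subseteq> X \<and> t < W A" X card] t unfolding A_def by auto
  have finA: "finite A" using A finX finite_subset by blast
  have "A \<noteq> {}" using A t by auto
  \<comment> \<open>Any vertex of \<open>A\<close> would do for the other claims; one of maximum degree also gives the last one.\<close>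
  then obtain v where v: "v \<in> A" "\<And>u. u \<in> A \<Longrightarrow> deg u A \<le> deg v A"
    using ex_is_arg_min_if_finite[of A "\<lambda>u. - deg u A"] finA
    unfolding is_arg_min_def by (auto simp: not_less)
  define U where "U = A - {v}"
  have U: "U \<subseteq> X" "v \<in> X" "v \<notin> U" "finite U" "insert v U = A" "card A = card U + 1"
    using v A finA card_Suc_Diff1[of A v] unfolding U_def by auto
  have "U \<noteq> {}" using card_ge2_of_W_pos[of A v] finA A t v unfolding U_def by simp
  have WU: "W U \<le> t"
  proof (rule ccontr)
    assume "\<not> W U \<le> t"
    then have "card A \<le> card U" using A_min U by simp
    then show False using U by simp
  qed
  have WA: "W A = W U + deg v U" using W_insert[of U v] U by simp
  have degA: "deg v A = deg v U" using deg_insert_self[of U v] U by simp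
  have "2 * W A = (\<Sum>u\<in>A. deg u A)" by (simp add: W_def cut_def)
  also have "\<dots> \<le> (\<Sum>u\<in>A. deg v A)" using v by (intro sum_mono) auto
  finally have avg: "2 * (W U + deg v U) \<le> (card U + 1) * deg v U"
    using WA degA U by simp
  have XU: "cut U X = 2 * W U + cut U (X - U)"
    using cut_Un_right[of U "X - U" U] U finX by (simp add: W_def Un_absorb1)
  have "S - U = (X - U) \<union> (S - X)" using S U by auto
  then have "cut U (S - U) = cut U (X - U) + cut U (S - X)"
    using cut_Un_right[of "X - U" "S - X" U] S finX by auto
  moreover have "c * cut U X \<le> cut U (S - X)"
    unfolding cut_def sum_distrib_left using deg U by (intro sum_mono) auto
  moreover have s: "deg v U \<le> cut U (X - U)"
    using cut_mono_right[of "X - U" "{v}" U] cut_commute[of U "{v}"] U finX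
    by (simp add: cut_singleton)
  moreover have "c * deg v U \<le> c * cut U (X - U)" using s c by (simp add: mult_left_mono)
  moreover have "W S = W U + W (S - U) + cut U (S - U)"
    using W_Un[of U "S - U"] U S by (simp add: Un_absorb1)
  ultimately have "W (S - U) \<le> W S - (1 + 2 * c) * W U - (1 + c) * deg v U"
    unfolding XU by (simp add: algebra_simps)
  then show thesis using that U \<open>U \<noteq> {}\<close> WU A WA avg by metis
qed

text \<open>One round of bisecting and, if necessary, shrinking with \<open>c = 1\<close>; the main
  argument runs it up to twice. The bound on \<open>deg v S\<close> holds since \<open>v\<close>
  sends at least as much weight to \<open>Z\<close> as to \<open>Y\<close>.\<close>

lemma min_bip_or_shrink:
  assumes S: "finite S" "2 \<le> card S" and t: "0 \<le> t"
  obtains (small) Y Z where "min_bip S Y Z" "W Y \<le> t" "W Z \<le> t"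
  | (large) Y Z U v where "min_bip S Y Z" "U \<subseteq> Y" "v \<in> Y" "v \<notin> U" "U \<noteq> {}" "Y - {v} \<noteq> {}"
    "W U \<le> t" "t < W U + deg v U" "W (S - U) \<le> W S - 3 * W U - 2 * deg v U"
    "2 * deg v U \<le> deg v S" "deg v U \<le> deg v Y"
proof -
  obtain Y Z where YZ: "min_bip S Y Z" "W Z \<le> W Y"
    using exists_min_bip[OF S] .
  show thesis
  proof (cases "W Y \<le> t")
    case True
    then show thesis using small YZ by simp
  next
    case False
    then have pos: "0 < W Y" "t < W Y" using t by auto
    have part: "Y \<union> Z = S" "Y \<inter> Z = {}" using YZ unfolding min_bip_def bip_def by auto
    then have SY: "S - Y = Z" "Y \<subseteq> S" and fin: "finite Y" "finite Z" using S by auto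
    have move: "deg u Y \<le> deg u Z" if "u \<in> Y" for u
      using min_bip_move[OF S(1) YZ(1) that pos(1)] .
    obtain U v where U: "U \<subseteq> Y" "v \<in> Y" "v \<notin> U" "U \<noteq> {}" "W U \<le> t" "t < W U + deg v U"
      "W (S - U) \<le> W S - (1 + 2 * 1) * W U - (1 + 1) * deg v U"
    proof (rule shrink_below_threshold[of S Y 1 t])
      show "1 * deg u Y \<le> deg u (S - Y)" if "u \<in> Y" for u using move[OF that] SY by simp
    qed (use S SY t pos in auto)
    have "deg v U \<le> deg v Y" using deg_mono U fin by blast
    moreover have "deg v S = deg v Y + deg v Z" using deg_Un fin part by blast
    ultimately show thesis
      using large[of Y Z U v] YZ U move[of v] by auto
  qed
qed

end

text \<open>
  Condition (i) for \<open>U\<close> and an optimal bisection of its complement: here \<open>x = W U\<close>,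
  \<open>W' = W (V - U)\<close> and \<open>r = card U\<close>.  For complete graphs with \<open>n\<close> congruent to 1
  modulo 3 it is sharp, which is why the two case distinctions below factor exactly.
\<close>
lemma average_bound:
  fixes w D x s W' n r :: real
  assumes w: "0 \<le> w" and D: "2 * w \<le> n * D" "3 * s \<le> D"
    and xs: "x \<le> (w + D) / 9" "(w + D) / 9 < x + s"
    and W': "0 \<le> W'" "W' \<le> w - 5 * x - 3 * s"
    and r: "1 \<le> r" "r + 2 \<le> n" and s: "2 * (x + s) \<le> (r + 1) * s"
  shows "x + W' * (1 - 1 / (n - r)) / 2 \<le> w * (1 - 2 / n) / 3"
proof -
  define R m where "R = r + 1" and "m = n - r"
  have m: "m = n + 1 - R" "2 \<le> m" "0 < n" and R: "2 \<le> R"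
    using r by (auto simp: m_def R_def)
  have spos: "0 < s" using xs by simp
  have Dpos: "0 < D" using D spos by linarith
  have sR: "2 * (w + D) \<le> 9 * s * R" using s xs by (simp add: R_def algebra_simps)
  \<comment> \<open>This is what remains of the goal once \<open>W'\<close> and then
    \<open>x\<close> are replaced by their bounds. Multiplying it by \<open>R\<close> lets
    \<open>sR\<close> eliminate \<open>s\<close>.\<close>
  have key: "12 * w * m \<le> D * (3 * m - 5) * n + 4 * w * n + 18 * s * n"
  proof -
    let ?K = "R * (3 * m - 5) + 4"
    have "0 \<le> R * (3 * m - 5)" using R m by simp
    then have K: "0 \<le> ?K" by simp
    have "2 * (w + D) * (2 * n) \<le> 9 * s * R * (2 * n)"
      using sR m by (intro mult_right_mono) auto
    then have step: "D * n * ?K + w * (4 * R * n - 12 * R * m + 4 * n)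
        \<le> R * (D * (3 * m - 5) * n + 4 * w * n + 18 * s * n - 12 * w * m)"
      by (simp add: algebra_simps)
    have "0 \<le> D * n * ?K + w * (4 * R * n - 12 * R * m + 4 * n)"
    proof (cases "n + 2 \<le> 3 * R")
      \<comment> \<open>Here \<open>2 * w \<le> n * D\<close> bounds \<open>D\<close> from below; in
        the other case \<open>DR\<close>, a consequence of \<open>3 * s \<le> D\<close>, takes
        over.\<close>
      case True
      have "0 \<le> 2 * w * ((3 * R - (n + 2)) * (R - 2))" using w True R by simp
      also have "\<dots> = 2 * w * ?K + w * (4 * R * n - 12 * R * m + 4 * n)"
        unfolding m(1) by (simp add: algebra_simps)
      also have "\<dots> \<le> D * n * ?K + w * (4 * R * n - 12 * R * m + 4 * n)"
        using mult_right_mono[OF D(1) K] by (simp add: algebra_simps)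
      finally show ?thesis .
    next
      case False
      have "9 * s * R \<le> 3 * D * R" using D R by (simp add: mult_right_mono)
      then have DR: "2 * w \<le> D * (3 * R - 2)" using sR by (simp add: algebra_simps)
      have "0 \<le> 6 * w * R * ((n - 2 * R + 2) * (n - 3 * R + 2))" using w False R by simp
      also have "\<dots> = 2 * w * (n * ?K) + (3 * R - 2) * (w * (4 * R * n - 12 * R * m + 4 * n))"
        unfolding m(1) by (simp add: algebra_simps)
      also have "\<dots> \<le> (3 * R - 2) * (D * n * ?K + w * (4 * R * n - 12 * R * m + 4 * n))"
      proof -
        have "2 * w * (n * ?K) \<le> D * (3 * R - 2) * (n * ?K)"
          using K m by (intro mult_right_mono[OF DR]) simp
        moreover have "(3 * R - 2) * (D * n * ?K + c) = D * (3 * R - 2) * (n * ?K) + (3 * R - 2) * c" for c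
          by (simp add: algebra_simps)
        ultimately show ?thesis by simp
      qed
      finally show ?thesis using R by (simp add: zero_le_mult_iff)
    qed
    with step have "0 \<le> R * (D * (3 * m - 5) * n + 4 * w * n + 18 * s * n - 12 * w * m)"
      by linarith
    then show ?thesis using R by (simp add: zero_le_mult_iff)
  qed
  \<comment> \<open>After \<open>W'\<close> is replaced, the coefficient of \<open>x\<close> is
    \<open>- (3 * m - 5)\<close>, which is negative; hence the lower bound on \<open>x\<close> is
    the one to insert.\<close>
  have "2 * m * x + (m - 1) * W' \<le> 2 * m * x + (m - 1) * (w - 5 * x - 3 * s)"
    using W' m by (simp add: mult_left_mono)
  also have "\<dots> = (m - 1) * (w - 3 * s) - (3 * m - 5) * x"
    by (simp add: algebra_simps)
  also have "\<dots> \<le> (m - 1) * (w - 3 * s) - (3 * m - 5) * ((w + D) / 9 - s)"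
  proof -
    have "(w + D) / 9 - s \<le> x" using xs by linarith
    then show ?thesis using m by (simp add: mult_left_mono)
  qed
  finally have "18 * m * x + 9 * (m - 1) * W' \<le> 6 * m * w - 4 * w - (3 * m - 5) * D - 18 * s"
    by (simp add: field_simps)
  then have "n * (18 * m * x + 9 * (m - 1) * W') \<le> n * (6 * m * w - 4 * w - (3 * m - 5) * D - 18 * s)"
    using m by (intro mult_left_mono) auto
  also have "\<dots> \<le> 6 * m * w * n - 12 * w * m" using key by (simp add: algebra_simps)
  finally have "n * (18 * m * x + 9 * (m - 1) * W') \<le> 6 * m * w * n - 12 * w * m" .
  moreover have "18 * m * n * (x + W' * (1 - 1 / m) / 2) = n * (18 * m * x + 9 * (m - 1) * W')"
    "18 * m * n * (w * (1 - 2 / n) / 3) = 6 * m * w * n - 12 * w * m"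
    using m(2,3) by (simp_all add: field_simps)
  ultimately have "18 * m * n * (x + W' * (1 - 1 / m) / 2) \<le> 18 * m * n * (w * (1 - 2 / n) / 3)"
    by (simp only:)
  moreover have "0 < 18 * m * n" using m by simp
  ultimately have "x + W' * (1 - 1 / m) / 2 \<le> w * (1 - 2 / n) / 3"
    using mult_le_cancel_left_pos by blast
  then show ?thesis by (simp add: m_def)
qed

section \<open>Construction of the judicious tripartition\<close>

context edge_weights
begin

text \<open>Condition (i) is stated through the complement of the crossing weight, as an upper bound
  on the inside weight.\<close>

lemma exists_judicious_tri_if_large:
  assumes V: "finite V" "3 \<le> card V" and D: "\<And>v. v \<in> V \<Longrightarrow> deg v V \<le> D"
    and X: "min_tri V X1 X2 X3" and X1: "(W V + D) / 9 < W X1"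
  shows "\<exists>X Y Z. tri V X Y Z \<and> W X + W Y + W Z \<le> W V * (1 - 2 / card V) / 3 \<and>
    W X \<le> (W V + D) / 9 \<and> W Y \<le> (W V + D) / 9 \<and> W Z \<le> (W V + D) / 9"
proof -
  define t n where "t = (W V + D) / 9" and "n = real (card V)"
  define ok where "ok = (\<lambda>X Y Z. W X + W Y + W Z \<le> W V * (1 - 2 / n) / 3)"
  have w: "0 \<le> W V" by (rule W_nonneg)
  have "2 * W V \<le> (\<Sum>v\<in>V. D)"
    using sum_mono[of V "\<lambda>v. deg v V" "\<lambda>_. D"] D by (simp add: W_def cut_def)
  then have Dn: "2 * W V \<le> n * D" by (simp add: n_def)
  have n: "3 \<le> n" using V by (simp add: n_def)
  have "0 \<le> n * D" using w Dn by linarith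
  then have D0: "0 \<le> D" using n by (simp add: zero_le_mult_iff)
  have t0: "0 \<le> t" unfolding t_def using w D0 by simp
  \<comment> \<open>A cruder sufficient test for (i), meant for partitions obtained by shrinking,
    which are not compared with a mean.\<close>
  have ok_D: "ok X Y Z" if "W X + W Y + W Z \<le> (W V - D) / 3" for X Y Z
  proof -
    have "2 * W V / n \<le> D" using Dn n by (simp add: field_simps)
    then show ?thesis using that unfolding ok_def by (simp add: algebra_simps)
  qed

  have part: "X1 \<union> X2 \<union> X3 = V" "X1 \<inter> X2 = {}" "X1 \<inter> X3 = {}" "X2 \<inter> X3 = {}" "X2 \<noteq> {}" "X3 \<noteq> {}"
    using X unfolding min_tri_def tri_def by auto
  then have sub: "X1 \<subseteq> V" "V - X1 = X2 \<union> X3" and fin: "finite X1" "finite X2" "finite X3"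
    using V by auto
  have pos: "0 < W X1" "t < W X1" using X1 t0 by (auto simp: t_def)
  have move: "deg u X1 \<le> deg u X2" "deg u X1 \<le> deg u X3" if "u \<in> X1" for u
    using min_tri_move[OF V(1) X that pos(1)] min_tri_move[OF V(1) min_tri_swap[OF X] that pos(1)] .
  have "2 * deg u X1 \<le> deg u (V - X1)" if "u \<in> X1" for u
    using move[OF that] deg_Un[of X2 X3 u] fin part sub by simp
  then obtain U v where U: "U \<subseteq> X1" "v \<in> X1" "v \<notin> U" "U \<noteq> {}" "W U \<le> t" "t < W U + deg v U"
    "W (V - U) \<le> W V - (1 + 2 * 2) * W U - (1 + 2) * deg v U"
    "2 * (W U + deg v U) \<le> (card U + 1) * deg v U"
    using shrink_below_threshold[of V X1 2 t] V sub t0 pos by auto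
  define s where "s = deg v U"
  have finU: "finite U" and UV: "U \<subseteq> V" using U fin finite_subset sub by auto
  have "deg v V = deg v X1 + deg v X2 + deg v X3"
    using deg_Un[of "X1 \<union> X2" X3 v] deg_Un[of X1 X2 v] fin part by auto
  moreover have "s \<le> deg v X1" unfolding s_def using deg_mono U fin by blast
  ultimately have s: "3 * s \<le> D" "0 \<le> s"
    using move[OF U(2)] D[of v] U sub deg_nonneg by (auto simp: s_def)
  let ?H = "V - U"
  have WH: "W ?H \<le> W V - 5 * W U - 3 * s" and ts: "t < W U + s" using U by (auto simp: s_def)
  \<comment> \<open>Three vertices in \<open>?H\<close> are needed so that two remain to be bisected
    after \<open>v'\<close> has left.\<close>
  have "card (insert v (X2 \<union> X3)) \<le> card ?H"
    using U part sub V by (intro card_mono) auto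
  moreover have "card (insert v (X2 \<union> X3)) \<ge> 3"
  proof -
    have "v \<notin> X2 \<union> X3" using U part by auto
    moreover have "card X2 \<ge> 1" "card X3 \<ge> 1" using part fin by (auto simp: Suc_le_eq card_gt_0_iff)
    ultimately show ?thesis using fin part by (simp add: card_Un_disjoint)
  qed
  ultimately have cardH: "3 \<le> card ?H" by linarith
  have nH: "real (card ?H) = n - card U"
    using UV V finU by (simp add: n_def card_Diff_subset of_nat_diff card_mono)
  have finH: "finite ?H" using V by simp
  have "1 \<le> real (card U)" using U finU by (simp add: Suc_le_eq card_gt_0_iff)
  then have avg: "W U + W ?H * (1 - 1 / card ?H) / 2 \<le> W V * (1 - 2 / n) / 3"
    unfolding nH using cardH nH
    by (intro average_bound[where D = D and s = s])
      (use w Dn s U WH W_nonneg in \<open>auto simp: t_def s_def add.commute\<close>)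
  have ok_min: "ok U Y Z" if YZ: "min_bip ?H Y Z" for Y Z
  proof -
    obtain Y' Z' where "bip ?H Y' Z'" "W Y' + W Z' \<le> W ?H * (1 - 1 / card ?H) / 2"
      using exists_bip_le_average[of ?H] finH cardH by auto
    then have "W Y + W Z \<le> W ?H * (1 - 1 / card ?H) / 2"
      using YZ unfolding min_bip_def by fastforce
    then show ?thesis using avg unfolding ok_def by linarith
  qed

  have "2 \<le> card ?H" using cardH by simp
  from finH this t0 show ?thesis
  proof (cases rule: min_bip_or_shrink)
    case (small Y Z)
    then show ?thesis
      using tri_bip[of U V Y Z] U UV ok_min[of Y Z]
      unfolding ok_def min_bip_def t_def n_def by blast
  next
    case (large Y Z U' v')
    define s' q where "s' = deg v' U'" and "q = deg v' U"
    have YZ: "Y \<union> Z = ?H" "Y \<inter> Z = {}" "Z \<noteq> {}" using large(1) unfolding min_bip_def bip_def by auto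
    have v': "v' \<in> V" "v' \<notin> U" and U'H: "U' \<subseteq> ?H" "U' \<noteq> ?H" using large YZ by auto
    have "deg v' V = q + deg v' ?H"
      unfolding q_def using deg_Un[of U ?H v'] finU finH UV by (simp add: Un_absorb1)
    then have q: "q + 2 * s' \<le> D" "0 \<le> q" "0 \<le> s'"
      using large D[OF v'(1)] deg_nonneg by (auto simp: s'_def q_def)
    have WR: "W (?H - U') \<le> W ?H - 3 * W U' - 2 * s'" and ts': "t < W U' + s'"
      using large by (auto simp: s'_def)
    show ?thesis
    proof (cases "W (?H - U') \<le> t")
      case True
      have "tri V U U' (?H - U')"
        using U UV large U'H by (intro tri_bip) (auto simp: bip_def)
      \<comment> \<open>The inside weight is at most \<open>W V - 4 * W U - 3 * s - 2 * t\<close>,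
        hence below \<open>W V - 6 * t + s\<close>; \<open>3 * s \<le> D\<close> finishes.\<close>
      moreover have "ok U U' (?H - U')"
        using WR ts' WH ts s by (intro ok_D) (simp add: t_def field_simps)
      ultimately show ?thesis
        using True U large unfolding ok_def t_def n_def by blast
    next
      case False
      \<comment> \<open>Combined with \<open>W ?H < W V - 5 * t + 2 * s\<close> and
        \<open>9 * t = W V + D\<close>, this gives \<open>D < 2 * s + s'\<close>. Then
        \<open>3 * s \<le> D\<close> yields \<open>s < s'\<close>, and
        \<open>q + 2 * s' \<le> D\<close> yields \<open>q < s\<close>.\<close>
      then have big: "4 * t < W ?H + s'" using WR ts' by linarith
      have 1: "D < 2 * s + s'" using big WH ts by (simp add: t_def field_simps)
      have 2: "q < s" using 1 q s by linarith
      have 3: "W U + q \<le> t"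
      proof (rule ccontr)
        \<comment> \<open>Using \<open>W U > t - q\<close> in \<open>WH\<close> gives
          \<open>D < 5 * q - 3 * s + s'\<close>; with \<open>2 * s' \<le> D - q\<close> this becomes
          \<open>D < 9 * q - 6 * s\<close>, which is below \<open>3 * s\<close>.\<close>
        assume "\<not> ?thesis"
        then show False using big WH 2 q s by (simp add: t_def field_simps)
      qed
      let ?U = "insert v' U" and ?H' = "V - insert v' U"
      have H': "?H' = ?H - {v'}" by auto
      have WU': "W ?U = W U + q" using W_insert finU v' by (simp add: q_def)
      have "W ?H' = W ?H - deg v' ?H"
        unfolding H' using W_remove finH v' by simp
      then have WH': "W ?H' \<le> W ?H - 2 * s'" using large by (simp add: s'_def)
      have finH': "finite ?H'" and cardH': "2 \<le> card ?H'"
        using finH cardH v' unfolding H' by (auto simp: card_Diff_singleton)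
      have bip': "bip ?H' (Y - {v'}) Z" using large YZ unfolding bip_def by auto
      \<comment> \<open>Moving \<open>v'\<close> from \<open>Y\<close> to \<open>U\<close> does not increase the inside weight, since \<open>q < s'\<close>.\<close>
      have okH': "ok ?U Y2 Z2" if "min_bip ?H' Y2 Z2" for Y2 Z2
      proof -
        have "W Y2 + W Z2 \<le> W (Y - {v'}) + W Z" using that bip' unfolding min_bip_def by blast
        moreover have "W (Y - {v'}) = W Y - deg v' Y"
          using W_remove large YZ finH by (metis finite_Un)
        moreover have "s' \<le> deg v' Y" using large by (simp add: s'_def)
        ultimately show ?thesis
          using ok_min[OF large(1)] WU' 1 2 s unfolding ok_def by linarith
      qed
      from finH' cardH' t0 show ?thesis
      proof (cases rule: min_bip_or_shrink)
        case (small Y2 Z2)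
        then show ?thesis
          using tri_bip[of ?U V Y2 Z2] UV v' WU' 3 okH'[of Y2 Z2]
          unfolding ok_def min_bip_def t_def n_def by (metis insert_not_empty insert_subset)
      next
        case (large Y2 Z2 U2 v2)
        have YZ2: "Y2 \<union> Z2 = ?H'" "Y2 \<inter> Z2 = {}" "Z2 \<noteq> {}"
          using large(1) unfolding min_bip_def bip_def by auto
        have v2: "v2 \<in> V" using large YZ2 by auto
        have "deg v2 ?H' \<le> deg v2 V" using deg_mono V by simp
        then have s2: "2 * deg v2 U2 \<le> D" using large D[OF v2] by linarith
        \<comment> \<open>The left side is below \<open>W V - 8 * t + D / 2\<close>, because
          \<open>s < s'\<close> and \<open>deg v2 U2 \<le> D / 2\<close>. For \<open>ok2\<close>,
          \<open>q < s < s'\<close> brings the inside weight below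
          \<open>W V - 6 * t\<close>.\<close>
        have R2: "W (?H' - U2) \<le> t"
          using large s2 WH' WH ts 1 s by (simp add: t_def field_simps)
        have ok2: "ok ?U U2 (?H' - U2)"
          using large WH' WH ts 1 2 s WU' by (intro ok_D) (simp add: t_def field_simps)
        have "tri V ?U U2 (?H' - U2)"
          using UV v' large YZ2 by (intro tri_bip) (auto simp: bip_def)
        then show ?thesis
          using R2 ok2 large WU' 3 unfolding ok_def t_def n_def by metis
      qed
    qed
  qed
qed

text \<open>A minimum tripartition inherits (i) from the average. If it violates (ii), a heavy part
  is relabelled as the first.\<close>

lemma exists_judicious_tri:
  assumes V: "finite V" "3 \<le> card V" and D: "\<And>v. v \<in> V \<Longrightarrow> deg v V \<le> D"
  shows "\<exists>X Y Z. tri V X Y Z \<and> W X + W Y + W Z \<le> W V * (1 - 2 / card V) / 3 \<and>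
    W X \<le> (W V + D) / 9 \<and> W Y \<le> (W V + D) / 9 \<and> W Z \<le> (W V + D) / 9"
proof -
  obtain X Y Z where X: "min_tri V X Y Z" using exists_min_tri[OF V] .
  then have X': "min_tri V Y X Z" "min_tri V Z Y X"
    unfolding min_tri_def tri_def by (auto simp: Int_commute ac_simps)
  obtain X' Y' Z' where "tri V X' Y' Z'" "W X' + W Y' + W Z' \<le> W V * (1 - 2 / card V) / 3"
    using exists_tri_le_average[OF V] .
  then have "tri V X Y Z" "W X + W Y + W Z \<le> W V * (1 - 2 / card V) / 3"
    using X unfolding min_tri_def by fastforce+
  then show ?thesis
    using exists_judicious_tri_if_large[OF V D] X X' by (meson not_le)
qed

end

section \<open>Transfer to weighted graphs\<close>

context weighted_graph
begin

text \<open>Extension by zero to non-edges turns sums over edges or neighbours into sums over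
  vertices.\<close>

definition edge_fun :: "'a \<Rightarrow> 'a \<Rightarrow> real" where
  "edge_fun u v = (if {u, v} \<in> E then w {u, v} else 0)"

sublocale edge_weights edge_fun
proof
  show "edge_fun u v = edge_fun v u" for u v by (simp add: edge_fun_def insert_commute)
  show "0 \<le> edge_fun u v" for u v by (simp add: edge_fun_def weight_nonneg)
  show "edge_fun u u = 0" for u using edges[of "{u}"] by (auto simp: edge_fun_def)
qed

lemma finite_edges: "finite E"
  using finite_subset[of E "Pow V"] edges finite_vertices by auto

text \<open>Adding \<open>v\<close> to \<open>S\<close> adds the edges \<open>{v, u}\<close> with
  \<open>u\<close> in \<open>S\<close>, in step with \<open>W_insert\<close>. The induction avoids
  matching unordered edges with ordered pairs.\<close>

lemma total_weight_induced: "S \<subseteq> V \<Longrightarrow> total_weight (induced_edges E S) w = W S"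
proof (induction S rule: infinite_finite_induct)
  case (infinite S)
  then show ?case using finite_vertices finite_subset by blast
next
  case empty
  have "{} \<notin> E" using edges[of "{}"] by auto
  then have "induced_edges E {} = {}" by (auto simp: induced_edges_def)
  then show ?case by (simp add: total_weight_def)
next
  case (insert v S)
  let ?N = "{u \<in> S. {v, u} \<in> E}"
  have "induced_edges E (insert v S) = induced_edges E S \<union> (\<lambda>u. {v, u}) ` ?N"
  proof (rule set_eqI, rule iffI)
    fix e assume e: "e \<in> induced_edges E (insert v S)"
    then have "e \<in> E" "e \<subseteq> insert v S" by (auto simp: induced_edges_def)
    show "e \<in> induced_edges E S \<union> (\<lambda>u. {v, u}) ` ?N"
    proof (cases "v \<in> e")
      case True
      obtain a b where "e = {a, b}" "a \<noteq> b" using edges[OF \<open>e \<in> E\<close>] by (meson card_2_iff)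
      then show ?thesis using True \<open>e \<in> E\<close> \<open>e \<subseteq> _\<close> by (auto simp: insert_commute)
    qed (use \<open>e \<in> E\<close> \<open>e \<subseteq> _\<close> in \<open>auto simp: induced_edges_def\<close>)
  qed (auto simp: induced_edges_def)
  moreover have "finite (induced_edges E S)" using finite_edges by (simp add: induced_edges_def)
  moreover have "induced_edges E S \<inter> (\<lambda>u. {v, u}) ` ?N = {}"
    using insert by (auto simp: induced_edges_def)
  ultimately have "total_weight (induced_edges E (insert v S)) w
      = total_weight (induced_edges E S) w + (\<Sum>e\<in>(\<lambda>u. {v, u}) ` ?N. w e)"
    unfolding total_weight_def using insert by (simp add: sum.union_disjoint)
  moreover have "(\<Sum>e\<in>(\<lambda>u. {v, u}) ` ?N. w e) = (\<Sum>u\<in>?N. w {v, u})"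
    by (subst sum.reindex) (auto simp: inj_on_def doubleton_eq_iff)
  moreover have "\<dots> = deg v S"
    unfolding deg_def edge_fun_def using insert by (simp add: sum.inter_filter)
  ultimately show ?case using insert W_insert by simp
qed

lemma total_weight_eq: "total_weight E w = W V"
proof -
  have "induced_edges E V = E" using edges by (auto simp: induced_edges_def)
  then show ?thesis using total_weight_induced[of V] by simp
qed

lemma weighted_degree_eq: "weighted_degree E w v = deg v V"
proof -
  have "neighbours E v = {u \<in> V. {v, u} \<in> E}" using edges by (auto simp: neighbours_def)
  then show ?thesis
    unfolding weighted_degree_def deg_def edge_fun_def using finite_vertices by (simp add: sum.inter_filter)
qed

text \<open>Each edge either crosses or lies inside exactly one part, as the parts are disjoint and
  edges are non-empty.\<close>

lemma crossing_weight:
  assumes "k_partition k V X"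
  shows "total_weight (crossing_edges E k X) w
    = total_weight E w - (\<Sum>i=1..k. total_weight (induced_edges E (X i)) w)"
proof -
  let ?I = "\<Union>i\<in>{1..k}. induced_edges E (X i)"
  have disj: "X i \<inter> X j = {}" if "i \<in> {1..k}" "j \<in> {1..k}" "i \<noteq> j" for i j
    using assms that by (auto simp: k_partition_def disjoint_family_on_def)
  have cover: "(\<Union>i\<in>{1..k}. X i) = V" using assms by (simp add: k_partition_def)
  have "crossing_edges E k X \<inter> ?I = {}"
  proof (rule ccontr)
    assume "\<not> ?thesis"
    then obtain e i j l u v where "i \<in> {1..k}" "j \<in> {1..k}" "l \<in> {1..k}" "i \<noteq> j"
      "u \<in> X i" "v \<in> X j" "{u, v} \<subseteq> X l"
      unfolding crossing_edges_def induced_edges_def by blast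
    \<comment> \<open>\<open>l\<close> differs from \<open>i\<close> or from \<open>j\<close>, so an
      endpoint would lie in two disjoint parts.\<close>
    then show False using disj[of i l] disj[of j l] by (cases "i = l") auto
  qed
  moreover have "crossing_edges E k X \<union> ?I = E"
  proof
    show "E \<subseteq> crossing_edges E k X \<union> ?I"
    proof
      fix e assume e: "e \<in> E"
      obtain a b where ab: "e = {a, b}" using edges[OF e] by (meson card_2_iff)
      then have "a \<in> V" "b \<in> V" using edges[OF e] by auto
      then obtain i j where ij: "i \<in> {1..k}" "a \<in> X i" "j \<in> {1..k}" "b \<in> X j"
        unfolding cover[symmetric] by blast
      then show "e \<in> crossing_edges E k X \<union> ?I"
      proof (cases "i = j")
        case True
        then have "e \<in> induced_edges E (X i)" using e ab ij by (simp add: induced_edges_def)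
        then show ?thesis using ij by blast
      next
        case False
        then have "e \<in> crossing_edges E k X"
          unfolding crossing_edges_def using e ab ij by (intro CollectI conjI bexI)
        then show ?thesis by simp
      qed
    qed
  qed (auto simp: crossing_edges_def induced_edges_def)
  moreover have "finite (crossing_edges E k X)" "finite ?I"
    using finite_edges by (auto simp: crossing_edges_def induced_edges_def)
  ultimately have "total_weight E w = total_weight (crossing_edges E k X) w + (\<Sum>e\<in>?I. w e)"
    unfolding total_weight_def using sum.union_disjoint[of "crossing_edges E k X" ?I w] by simp
  moreover have "(\<Sum>e\<in>?I. w e) = (\<Sum>i=1..k. total_weight (induced_edges E (X i)) w)"
    unfolding total_weight_def
  proof (rule sum.UNION_disjoint)
    show "\<forall>i\<in>{1..k}. \<forall>j\<in>{1..k}. i \<noteq> j \<longrightarrow> induced_edges E (X i) \<inter> induced_edges E (X j) = {}"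
    proof (intro ballI impI equals0I)
      fix i j e
      assume ij: "i \<in> {1..k}" "j \<in> {1..k}" "i \<noteq> j"
        and "e \<in> induced_edges E (X i) \<inter> induced_edges E (X j)"
      then have e: "e \<in> E" "e \<subseteq> X i \<inter> X j" by (auto simp: induced_edges_def)
      then have "e = {}" using disj[OF ij] by simp
      then show False using edges[OF e(1)] by simp
    qed
  qed (auto simp: induced_edges_def finite_edges)
  ultimately show ?thesis by simp
qed

end

theorem theorem5:
  fixes V :: "'a set" and E :: "'a set set" and w :: "'a set \<Rightarrow> real"
  assumes "weighted_graph V E w" and "card V \<ge> 3"
  shows "\<exists>X. k_partition 3 V X \<and>
    total_weight (crossing_edges E 3 X) w
      \<ge> 2 * total_weight E w / 3 + avg_weighted_degree V E w / 3 \<and>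
    Max ((\<lambda>i. total_weight (induced_edges E (X i)) w) ` {1..3})
      \<le> total_weight E w / 9 + max_weighted_degree V E w / 9"
proof -
  interpret weighted_graph V E w by fact
  let ?D = "max_weighted_degree V E w"
  have "deg v V \<le> ?D" if "v \<in> V" for v
    unfolding max_weighted_degree_def using that finite_vertices
    by (auto simp: weighted_degree_eq[symmetric] intro!: Max_ge)
  then obtain A B C where tri: "tri V A B C"
    and sum: "W A + W B + W C \<le> W V * (1 - 2 / card V) / 3"
    and each: "W A \<le> (W V + ?D) / 9" "W B \<le> (W V + ?D) / 9" "W C \<le> (W V + ?D) / 9"
    using exists_judicious_tri[OF finite_vertices assms(2), of ?D] by blast
  define X where "X = (\<lambda>i::nat. if i = 1 then A else if i = 2 then B else C)"
  have three: "{1..3} = {1, 2, 3::nat}" by auto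
  have X: "X 1 = A" "X 2 = B" "X 3 = C" by (auto simp: X_def)
  have part: "k_partition 3 V X"
    using tri unfolding k_partition_def disjoint_family_on_def tri_def three by (auto simp: X[simplified])
  have WX: "total_weight (induced_edges E A) w = W A" "total_weight (induced_edges E B) w = W B"
    "total_weight (induced_edges E C) w = W C"
    using tri by (auto simp: tri_def intro!: total_weight_induced)
  have "total_weight (crossing_edges E 3 X) w = W V - (W A + W B + W C)"
    unfolding crossing_weight[OF part] three using X by (simp add: WX total_weight_eq)
  \<comment> \<open>\<open>avg_weighted_degree V E w / 3\<close> is
    \<open>2 * W V / (3 * card V)\<close>, so this is \<open>sum\<close> rearranged.\<close>
  then have "total_weight (crossing_edges E 3 X) w
      \<ge> 2 * total_weight E w / 3 + avg_weighted_degree V E w / 3"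
    using sum by (simp add: avg_weighted_degree_def total_weight_eq algebra_simps)
  moreover have "Max ((\<lambda>i. total_weight (induced_edges E (X i)) w) ` {1..3})
      \<le> total_weight E w / 9 + ?D / 9"
    unfolding three using each by (simp add: X[simplified] WX total_weight_eq add_divide_distrib)
  ultimately show ?thesis using part by blast
qed

end
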